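(* Let $\mathcal{T}\in\mathbb{R}^{n_1\times n_2\times n_3}$ satisfy $\mathcal{T}=(U_1^{\#},U_2^{\#},U_3^{\#}).\mathcal{G}^{\#}$ where $U_i^{\#}\in\mathbb{R}^{n_i\times r_i}_+$ with $(U_i^{\#})^\top e=e$ for $i\in\{1,2,3\}$ and $\mathcal{G}^{\#}\in\mathbb{R}^{r_1\times r_2\times r_3}$. Assume that $\sqrt{r_3}\le r=r_1=r_2$, that $U_i^{\#}$ satisfies the SSC for $i\in\{1,2,3\}$, that $i^*\in\{1,\dots,n_3\}$ is such that $\operatorname{rank}(\mathcal{T}^{(3)}_{i^*})=r$, and that $\operatorname{rank}(\mathcal{G}^{\#}_{(3)})=r_3$. Let $(U_1^*,U_2^*,U_3^*,\mathcal{G}^* )$ be any output of the following procedure: 1. Let $(U_1^*,U_2^*,S_{i^*}^* )$ be an optimal solution of $$\min_{U_1\in\mathbb{R}^{n_1\times r},\,U_2\in\mathbb{R}^{n_2\times r},\,S_{i^*}\in\mathbb{R}^{r\times r}}|\det(S_{i^*})|\ \text{ such that }\ \mathcal{T}^{(3)}_{i^*}=U_1S_{i^*}U_2^\top,\ U_i^\top e=e,\ U_i\ge0\text{ for }i\in\{1,2\}.$$ 2. Let $S^*\in\mathbb{R}^{r^2\times n_3}$ be the matrix whose $i$-th column is $\operatorname{vec}\big((U_1^* )^\dagger\mathcal{T}^{(3)}_i((U_2^* )^\top)^\dagger\big)$ for $i\in\{1,\dots,n_3\}$, and let $(\mathcal{G}^*_{(3)},U_3^* )$ be an optimal solution of $$\min_{\mathcal{G}_{(3)}\in\mathbb{R}^{r^2\times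 r_3},\,U_3\in\mathbb{R}^{n_3\times r_3}}\det(\mathcal{G}_{(3)}^\top\mathcal{G}_{(3)})\ \text{ such that }\ S^*=\mathcal{G}_{(3)}U_3^\top,\ U_3^\top e=e,\ U_3\ge0;$$ let $\mathcal{G}^*\in\mathbb{R}^{r\times r\times r_3}$ be the tensor with third-mode unfolding $\mathcal{G}^*_{(3)}$. Then there exist permutation matrices $\Pi_1,\Pi_2,\Pi_3$ such that $U_i^*=U_i^{\#}\Pi_i$ for all $i\in\{1,2,3\}$ and $\mathcal{G}^*=(\Pi_1^\top,\Pi_2^\top,\Pi_3^\top).\mathcal{G}^{\#}$.
   Context: $e$ is the all-ones vector of appropriate dimension, $e_k$ the $k$-th standard basis vector, $\ge$ is entrywise, $U^\dagger$ denotes the Moore-Penrose inverse, and $\operatorname{vec}$ vectorizes a matrix columnwise. For matrices $U_i\in\mathbb{R}^{n_i\times r_i}$ and $\mathcal{G}\in\mathbb{R}^{r_1\times r_2\times r_3}$, the tensor $(U_1,U_2,U_3).\mathcal{G}\in\mathbb{R}^{n_1\times n_2\times n_3}$ has entries $\sum_{i_1,i_2,i_3}(U_1)_{j_1,i_1}(U_2)_{j_2,i_2}(U_3)_{j_3,i_3}\mathcal{G}_{i_1,i_2,i_3}$. The $k$-th slice along the third mode of $\mathcal{T}\in\mathbb{R}^{n_1\times n_2\times n_3}$ is $\mathcal{T}^{(3)}_k\in\mathbb{R}^{n_1\times n_2}$ with $(\mathcal{T}^{(3)}_k)_{i,j}=\mathcal{T}_{i,j,k}$. The third-mode unfolding is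 $\mathcal{T}_{(3)}\in\mathbb{R}^{n_1n_2\times n_3}$ with $(\mathcal{T}_{(3)})_{(i,j),k}=\mathcal{T}_{i,j,k}$, where $(i,j)$ stands for the index $i+(j-1)n_1$. For $A\in\mathbb{R}^{m\times n}$, $\operatorname{cone}(A)=\{Ay : y\in\mathbb{R}^n, y\ge 0\}$ and $\operatorname{cone}^*(A)=\{y\in\mathbb{R}^m : A^\top y\ge 0\}$. A matrix $H\in\mathbb{R}^{n\times r}_+$ with $r\ge2$ satisfies the sufficiently scattered condition (SSC) if: (SSC1) $\{x\in\mathbb{R}^r_+ : e^\top x\ge\sqrt{r-1}\,\|x\|_2\}\subseteq\operatorname{cone}(H^\top)$; and (SSC2) $\operatorname{cone}^*(H^\top)\cap\operatorname{bd}(\mathcal{C}^* )=\{\lambda e_k : \lambda\ge0,\ k\in\{1,\dots,r\}\}$, where $\mathcal{C}^*=\{x\in\mathbb{R}^r : e^\top x\ge\|x\|_2\}$ and $\operatorname{bd}$ denotes the boundary. *)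

theory Defs
  imports "HOL-Analysis.Analysis"
begin

text \<open>
  Vectors and matrices are those of HOL-Analysis: an \<open>m \<times> n\<close> matrix has type \<open>real^'n^'m\<close>, the
  order \<open>\<le>\<close> on vectors and matrices is entrywise, and \<open>1 :: real^'n\<close> is the all-ones vector \<open>e\<close>.
\<close>

abbreviation all_ones :: "real^'n"
  where "all_ones \<equiv> 1"

text \<open>The Moore-Penrose inverse is the unique matrix satisfying the four Penrose equations.\<close>

definition is_moore_penrose :: "real^'n^'m \<Rightarrow> real^'m^'n \<Rightarrow> bool" where
  "is_moore_penrose A X \<longleftrightarrow>
     A ** X ** A = A \<and> X ** A ** X = X \<and>
     transpose (A ** X) = A ** X \<and> transpose (X ** A) = X ** A"

definition pinv :: "real^'n^'m \<Rightarrow> real^'m^'n" where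
  "pinv A = (THE X. is_moore_penrose A X)"

text \<open>The entry \<open>(i, j, k)\<close> of a third-order tensor \<open>T\<close> is \<open>T $ i $ j $ k\<close>.\<close>

type_synonym ('n1, 'n2, 'n3) tensor3 = "real^'n3^'n2^'n1"

definition tensor_apply ::
  "real^'r1^'n1 \<Rightarrow> real^'r2^'n2 \<Rightarrow> real^'r3^'n3 \<Rightarrow>
   ('r1::finite, 'r2::finite, 'r3::finite) tensor3 \<Rightarrow> ('n1::finite, 'n2::finite, 'n3::finite) tensor3"
  where
  "tensor_apply U1 U2 U3 G =
     (\<chi> j1 j2 j3. \<Sum>i1\<in>UNIV. \<Sum>i2\<in>UNIV. \<Sum>i3\<in>UNIV.
        U1 $ j1 $ i1 * U2 $ j2 $ i2 * U3 $ j3 $ i3 * G $ i1 $ i2 $ i3)"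

definition slice3 :: "('n1::finite, 'n2::finite, 'n3::finite) tensor3 \<Rightarrow> 'n3 \<Rightarrow> real^'n2^'n1" where
  "slice3 T k = (\<chi> i j. T $ i $ j $ k)"

text \<open>
  The rows of the third-mode unfolding, and the entries of a vectorized matrix, are indexed by the
  pairs \<open>(i, j)\<close> themselves instead of the numbers \<open>i + (j - 1) n\<^sub>1\<close>. Since both
  functions use the same indexing, \<open>vectorize (slice3 T k)\<close> is the \<open>k\<close>-th column of \<open>unfold3 T\<close>.
\<close>

definition unfold3 ::
  "('n1::finite, 'n2::finite, 'n3::finite) tensor3 \<Rightarrow> real^'n3^('n1 \<times> 'n2)" where
  "unfold3 T = (\<chi> p k. T $ fst p $ snd p $ k)"

definition vectorize :: "real^'n2^'n1 \<Rightarrow> real^('n1::finite \<times> 'n2::finite)" where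
  "vectorize M = (\<chi> p. M $ fst p $ snd p)"

definition mat_cone :: "real^'n^'m \<Rightarrow> (real^'m) set" where
  "mat_cone A = {A *v y | y. 0 \<le> y}"

definition mat_dual_cone :: "real^'n^'m \<Rightarrow> (real^'m) set" where
  "mat_dual_cone A = {y. 0 \<le> transpose A *v y}"

definition soc_dual :: "(real^'r) set" where
  "soc_dual = {x. norm x \<le> all_ones \<bullet> x}"

definition SSC1 :: "real^'r^'n \<Rightarrow> bool" where
  "SSC1 H \<longleftrightarrow>
     {x :: real^'r. 0 \<le> x \<and> sqrt (real CARD('r) - 1) * norm x \<le> all_ones \<bullet> x}
       \<subseteq> mat_cone (transpose H)"

definition SSC2 :: "real^'r^'n \<Rightarrow> bool" where
  "SSC2 H \<longleftrightarrow>
     mat_dual_cone (transpose H) \<inter> frontier soc_dual = {c *\<^sub>R axis k 1 | c k. 0 \<le> c}"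

definition sufficiently_scattered :: "real^'r^'n \<Rightarrow> bool" where
  "sufficiently_scattered H \<longleftrightarrow> 2 \<le> CARD('r) \<and> 0 \<le> H \<and> SSC1 H \<and> SSC2 H"

definition permutation_matrix :: "real^'r^'r \<Rightarrow> bool" where
  "permutation_matrix P \<longleftrightarrow> (\<exists>\<sigma>. \<sigma> permutes UNIV \<and> P = (\<chi> i j. if i = \<sigma> j then 1 else 0))"

definition step1_feasible ::
  "real^'n2^'n1 \<Rightarrow> (real^'r^'n1) \<times> (real^'r^'n2) \<times> (real^'r^'r) \<Rightarrow> bool" where
  "step1_feasible M = (\<lambda>(U1, U2, S).
     M = U1 ** S ** transpose U2 \<and>
     transpose U1 *v all_ones = all_ones \<and> transpose U2 *v all_ones = all_ones \<and>
     0 \<le> U1 \<and> 0 \<le> U2)"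

definition step1_optimal ::
  "real^'n2^'n1 \<Rightarrow> (real^'r^'n1) \<times> (real^'r^'n2) \<times> (real^'r^'r) \<Rightarrow> bool" where
  "step1_optimal M = is_arg_min (\<lambda>(U1, U2, S). \<bar>det S\<bar>) (step1_feasible M)"

definition step2_matrix ::
  "('n1::finite, 'n2::finite, 'n3::finite) tensor3 \<Rightarrow> real^'r^'n1 \<Rightarrow> real^'r^'n2 \<Rightarrow>
   real^'n3^('r::finite \<times> 'r)" where
  "step2_matrix T U1 U2 =
     (\<chi> p i. vectorize (pinv U1 ** slice3 T i ** pinv (transpose U2)) $ p)"

definition step2_feasible :: "real^'n3^'p \<Rightarrow> (real^'r3^'p) \<times> (real^'r3^'n3) \<Rightarrow> bool" where
  "step2_feasible S = (\<lambda>(G, U3).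
     S = G ** transpose U3 \<and> transpose U3 *v all_ones = all_ones \<and> 0 \<le> U3)"

definition step2_optimal :: "real^'n3^'p \<Rightarrow> (real^'r3^'p) \<times> (real^'r3^'n3) \<Rightarrow> bool" where
  "step2_optimal S = is_arg_min (\<lambda>(G, U3). det (transpose G ** G)) (step2_feasible S)"

text \<open>
  The outputs of the two-step procedure applied to \<open>T\<close> with slice index \<open>k\<close>; the core tensor \<open>G\<close> is
  determined by its unfolding, which is the first component of a solution of the second step.
\<close>

definition procedure_output ::
  "('n1::finite, 'n2::finite, 'n3::finite) tensor3 \<Rightarrow> 'n3 \<Rightarrow>
   real^'r^'n1 \<Rightarrow> real^'r^'n2 \<Rightarrow> real^'r3^'n3 \<Rightarrow>
   ('r::finite, 'r, 'r3::finite) tensor3 \<Rightarrow> bool" where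
  "procedure_output T k U1 U2 U3 G \<longleftrightarrow>
     (\<exists>S. step1_optimal (slice3 T k) (U1, U2, S)) \<and>
     step2_optimal (step2_matrix T U1 U2) (unfold3 G, U3)"

end

theory Submission
  imports Defs
begin

text \<open>
  Full rank makes the computed factor and the true one span the same column space, so
  \<open>U = H Q\<close> with \<open>Q\<close> square. Since \<open>H\<close> and \<open>H Q\<close> are column stochastic, the columns of
  \<open>Q\<close> have entry sum \<open>1\<close> and lie in the dual cone of the rows of \<open>H\<close>, which by SSC1 is
  contained in the second-order cone \<open>\<parallel>q\<parallel> \<le> e\<^sup>T q\<close>. So they have norm at most \<open>1\<close>, and Hadamard's
  inequality gives \<open>\<bar>det Q\<bar> \<le> 1\<close>. Comparing the optimum with the true factorization gives the
  converse inequality, hence all columns have norm exactly \<open>1\<close>, lie on the boundary of the cone,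
  and are unit vectors by SSC2: \<open>Q\<close> is a permutation matrix. The argument is applied to the two
  factors of a slice in the first step, and to the third factor in the second step.
\<close>

section \<open>Hadamard's inequality\<close>

text \<open>With the other rows fixed, the determinant is a linear functional of row
  \<open>k\<close>; it can then be represented by a vector, or the row rescaled.\<close>

lemma linear_det_row:
  fixes A :: "real^'n^'n"
  shows "linear (\<lambda>x. det (\<chi> i. if i = k then x else A $ i))"
proof (rule linearI)
  show "det (\<chi> i. if i = k then x + y else A $ i) =
      det (\<chi> i. if i = k then x else A $ i) + det (\<chi> i. if i = k then y else A $ i)" for x y
    using det_row_add[of k "\<lambda>_. x" "\<lambda>_. y" "\<lambda>i. A $ i"] by simp
  show "det (\<chi> i. if i = k then c *\<^sub>R x else A $ i) =
      c *\<^sub>R det (\<chi> i. if i = k then x else A $ i)" for c x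
    using det_row_mul[of k c "\<lambda>_. x" "\<lambda>i. A $ i"] by (simp add: scalar_mult_eq_scaleR cong: if_cong)
qed

lemma continuous_on_det: "continuous_on S (det :: real^'n^'n \<Rightarrow> real)"
  unfolding det_def by (intro continuous_intros)

text \<open>
  A maximiser of \<open>\<bar>det\<bar>\<close> on the set of matrices with rows in the unit ball is orthogonal: as a
  function of row \<open>k\<close> the determinant is \<open>x \<mapsto> c \<bullet> x\<close>, so row \<open>k\<close> is parallel to \<open>c\<close>,
  and \<open>c\<close> is orthogonal to the other rows because a repeated row makes the determinant vanish.
\<close>

lemma det_le_1_of_norm_rows_le_1:
  fixes B :: "real^'n^'n"
  assumes B: "\<And>i. norm (B $ i) \<le> 1"
  shows "\<bar>det B\<bar> \<le> 1"
proof -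
  let ?S = "{A :: real^'n^'n. \<forall>i. norm (A $ i) \<le> 1}"
  have "closed ?S"
    by (intro closed_Collect_all closed_Collect_le continuous_intros)
  moreover have "bounded ?S"
  proof (rule boundedI)
    fix A assume "A \<in> ?S"
    have "norm A \<le> (\<Sum>i\<in>UNIV. norm (A $ i))"
      unfolding norm_vec_def by (rule L2_set_le_sum) simp
    also have "\<dots> \<le> (\<Sum>i\<in>(UNIV::'n set). 1)"
      using \<open>A \<in> ?S\<close> by (intro sum_mono) auto
    finally show "norm A \<le> (\<Sum>i\<in>(UNIV::'n set). 1)" .
  qed
  ultimately have "compact ?S"
    by (simp add: compact_eq_bounded_closed)
  moreover have id_mem: "mat 1 \<in> ?S"
  proof -
    have "mat 1 $ i = axis i (1::real)" for i :: 'n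
      by (simp add: mat_def axis_def vec_eq_iff)
    then show ?thesis by (simp add: norm_axis_1)
  qed
  ultimately have "\<exists>A\<in>?S. \<forall>C\<in>?S. \<bar>det C\<bar> \<le> \<bar>det A\<bar>"
    by (intro continuous_attains_sup continuous_on_rabs continuous_on_det) blast+
  then obtain A where A: "A \<in> ?S" and max: "\<And>C. C \<in> ?S \<Longrightarrow> \<bar>det C\<bar> \<le> \<bar>det A\<bar>"
    by blast
  have D: "1 \<le> \<bar>det A\<bar>"
    using max[OF id_mem] by simp
  have row_k: "norm (A $ k) = 1 \<and> (\<forall>j. j \<noteq> k \<longrightarrow> A $ k \<bullet> A $ j = 0)" for k
  proof -
    let ?f = "\<lambda>x. det (\<chi> i. if i = k then x else A $ i)"
    \<comment> \<open>The adjoint of a real-valued functional, evaluated at 1, is its representing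
      vector.\<close>
    define c where "c = adjoint ?f 1"
    have c: "?f x = c \<bullet> x" for x
      using adjoint_works[OF linear_det_row, of x k A 1] by (simp add: c_def inner_commute)
    have "(\<chi> i. if i = k then A $ k else A $ i) = A"
      by (simp add: vec_eq_iff)
    then have det_A: "det A = c \<bullet> A $ k"
      using c[of "A $ k"] by simp
    have "c \<noteq> 0"
      using det_A D by auto
    \<comment> \<open>The unit vector along \<open>c\<close> in row \<open>k\<close> gives a
      competitor; maximality and Cauchy-Schwarz then force equality.\<close>
    have "\<bar>?f (c /\<^sub>R norm c)\<bar> \<le> \<bar>det A\<bar>"
      using A \<open>c \<noteq> 0\<close> by (intro max) auto
    moreover have "c \<bullet> (c /\<^sub>R norm c) = norm c"
      using \<open>c \<noteq> 0\<close> by (simp add: dot_square_norm power2_eq_square)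
    ultimately have "norm c \<le> \<bar>c \<bullet> A $ k\<bar>"
      by (simp only: c det_A abs_norm_cancel)
    moreover have "\<bar>c \<bullet> A $ k\<bar> \<le> norm c * norm (A $ k)"
      by (rule Cauchy_Schwarz_ineq2)
    moreover have le1: "norm (A $ k) \<le> 1"
      using A by simp
    ultimately have norm1: "norm (A $ k) = 1"
      using \<open>c \<noteq> 0\<close>
      by (smt (verit) mult_le_cancel_left1 zero_less_norm_iff)
    have "\<bar>c \<bullet> A $ k\<bar> = norm c * norm (A $ k)"
      using \<open>norm c \<le> _\<close> \<open>\<bar>c \<bullet> A $ k\<bar> \<le> _\<close> norm1 by simp
    then have "norm c *\<^sub>R A $ k = c \<or> norm c *\<^sub>R A $ k = - c"
      using norm_cauchy_schwarz_abs_eq[of c "A $ k"] norm1 by simp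
    moreover have "c \<bullet> A $ j = 0" if "j \<noteq> k" for j
      unfolding c[symmetric] using that by (intro det_identical_rows[of j k]) (auto simp: row_def vec_eq_iff)
    ultimately have "(norm c *\<^sub>R A $ k) \<bullet> A $ j = 0" if "j \<noteq> k" for j
      using that by (metis inner_minus_left neg_0_equal_iff_equal)
    then show ?thesis
      using norm1 \<open>c \<noteq> 0\<close> by auto
  qed
  have row_eq: "row i A = A $ i" for i
    by (simp add: row_def vec_eq_iff)
  have "orthogonal_matrix A"
    unfolding orthogonal_matrix_orthonormal_rows row_eq orthogonal_def using row_k by metis
  then have "\<bar>det A\<bar> = 1"
    using det_orthogonal_matrix by fastforce
  moreover have "\<bar>det B\<bar> \<le> \<bar>det A\<bar>"
    using B by (intro max) auto
  ultimately show ?thesis by simp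
qed

text \<open>Equality case of the bound: stretching a shorter row to unit length would divide
  \<open>det B\<close> by the norm of that row and push its absolute value beyond 1.\<close>

lemma norm_row_eq_1_of_det_ge_1:
  fixes B :: "real^'n^'n"
  assumes B: "\<And>i. norm (B $ i) \<le> 1" and det: "1 \<le> \<bar>det B\<bar>"
  shows "norm (B $ k) = 1"
proof (rule ccontr)
  let ?f = "\<lambda>x. det (\<chi> i. if i = k then x else B $ i)"
  assume "norm (B $ k) \<noteq> 1"
  then have lt: "norm (B $ k) < 1"
    using B[of k] by simp
  have "row k B = B $ k"
    by (simp add: row_def vec_eq_iff)
  then have nz: "B $ k \<noteq> 0"
    using det det_zero_row(1)[where i = k and A = B] by auto
  have "(\<chi> i. if i = k then B $ k else B $ i) = B"
    by (simp add: vec_eq_iff)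
  then have "?f (B $ k /\<^sub>R norm (B $ k)) = det B / norm (B $ k)"
    using linear_cmul[OF linear_det_row[of k B]] by (simp add: divide_inverse mult.commute)
  moreover have "\<bar>?f (B $ k /\<^sub>R norm (B $ k))\<bar> \<le> 1"
    using B nz by (intro det_le_1_of_norm_rows_le_1) auto
  ultimately have "\<bar>det B / norm (B $ k)\<bar> \<le> 1"
    by simp
  then have "\<bar>det B\<bar> \<le> norm (B $ k)"
    using nz by (simp add: abs_divide)
  then show False
    using lt det by simp
qed

section \<open>The sufficiently scattered condition\<close>

lemma inner_1_1: "(1::real^'r) \<bullet> 1 = real CARD('r)"
  by (simp add: inner_vec_def)

lemma inner_1_axis: "(1::real^'r) \<bullet> axis k 1 = 1"
  by (simp add: inner_axis)

text \<open>Cauchy-Schwarz on the coordinates other than \<open>i\<close> bounds their sum by the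
  left side of the assumption, which leaves no room for a negative \<open>x $ i\<close>. This brings
  points of the cone into the set of SSC1.\<close>

lemma nonneg_of_second_order_cone:
  fixes x :: "real^'r"
  assumes x: "sqrt (real CARD('r) - 1) * norm x \<le> 1 \<bullet> x"
  shows "0 \<le> x"
proof -
  have "0 \<le> x $ i" for i
  proof (rule ccontr)
    assume neg: "\<not> 0 \<le> x $ i"
    let ?u = "1 - axis i 1 :: real^'r" and ?y = "x - x $ i *\<^sub>R axis i 1"
    have "?u \<bullet> ?u = real CARD('r) - 1"
      by (simp add: inner_diff_left inner_diff_right inner_1_1 inner_1_axis inner_commute[of "axis i 1"] inner_axis_axis)
    then have u: "norm ?u = sqrt (real CARD('r) - 1)"
      by (simp add: norm_eq_sqrt_inner)
    have "?y \<bullet> ?y = x \<bullet> x - (x $ i)\<^sup>2"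
      by (simp add: inner_diff_left inner_diff_right inner_axis inner_axis' inner_axis_axis power2_eq_square)
    then have y: "norm ?y \<le> norm x"
      by (simp add: norm_eq_sqrt_inner)
    have "1 \<bullet> x - x $ i = ?u \<bullet> ?y"
      by (simp add: inner_diff_left inner_diff_right inner_axis inner_axis' inner_axis_axis inner_1_axis)
    also have "\<dots> \<le> norm ?u * norm ?y"
      by (rule norm_cauchy_schwarz)
    also have "\<dots> \<le> sqrt (real CARD('r) - 1) * norm x"
      unfolding u by (rule mult_left_mono[OF y]) (simp add: Suc_leI)
    finally show False
      using x neg by simp
  qed
  then show ?thesis
    by (simp add: less_eq_vec_def)
qed

text \<open>Two test points of the cone suffice: \<open>1\<close> shows that the mean
  \<open>a\<close> of the entries of \<open>q\<close> is nonnegative, and \<open>?x\<close> bounds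
  the part \<open>w\<close> of \<open>q\<close> orthogonal to \<open>1\<close> in terms of
  \<open>a\<close>.\<close>

lemma mem_soc_dual_of_dual_cone:
  fixes q :: "real^'r"
  assumes q: "\<And>x :: real^'r. sqrt (real CARD('r) - 1) * norm x \<le> 1 \<bullet> x \<Longrightarrow> 0 \<le> x \<bullet> q"
  shows "norm q \<le> 1 \<bullet> q"
proof -
  define r where "r = real CARD('r)"
  have r: "r \<ge> 1"
    by (simp add: r_def Suc_leI)
  define a where "a = (1 \<bullet> q) / r"
  define w where "w = q - a *\<^sub>R 1"
  let ?N = "norm w"
  have ar: "1 \<bullet> q = a * r"
    using r by (simp add: a_def)
  have ew: "1 \<bullet> w = 0"
    by (simp add: w_def inner_diff_right inner_1_1 ar r_def)
  then have we: "w \<bullet> 1 = 0"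
    by (simp add: inner_commute)
  have q_eq: "q = a *\<^sub>R 1 + w"
    by (simp add: w_def)
  have wq: "w \<bullet> q = ?N\<^sup>2"
    by (simp add: q_eq inner_add_right we dot_square_norm)
  have qq: "(norm q)\<^sup>2 = a\<^sup>2 * r + ?N\<^sup>2"
    unfolding dot_square_norm[symmetric]
    by (subst (1 2) q_eq) (simp add: inner_add_right inner_add_left we ew inner_1_1 r_def power2_eq_square)
  have "sqrt (r - 1) * norm (1::real^'r) \<le> sqrt r * sqrt r"
    unfolding norm_eq_sqrt_inner inner_1_1 r_def[symmetric] using r by (intro mult_right_mono) auto
  then have "0 \<le> 1 \<bullet> q"
    using q[of 1] r by (simp add: inner_1_1 r_def)
  then have a0: "0 \<le> a"
    using r by (simp add: a_def)
  \<comment> \<open>the point of the cone where \<open>x \<bullet> q\<close> is smallest, up to a positive factor\<close>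
  let ?x = "(?N * sqrt (r - 1)) *\<^sub>R 1 - sqrt r *\<^sub>R w"
  have "?x \<bullet> ?x = (?N * r)\<^sup>2"
    using r unfolding inner_diff_left inner_diff_right inner_scaleR_left inner_scaleR_right
    by (simp add: we ew inner_1_1 dot_square_norm[of w] power2_eq_square r_def[symmetric] algebra_simps)
  then have "norm ?x = ?N * r"
    using r by (simp add: norm_eq_sqrt_inner)
  then have "0 \<le> ?x \<bullet> q"
    by (intro q) (simp add: r_def[symmetric] inner_diff_right inner_1_1 ew)
  then have "?N * (sqrt r * ?N) \<le> ?N * (sqrt (r - 1) * a * r)"
    by (simp add: inner_diff_left ar wq power2_eq_square algebra_simps)
  \<comment> \<open>Cancel \<open>?N\<close>; if it is zero, the right side is still
    nonnegative.\<close>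
  then have "sqrt r * ?N \<le> sqrt (r - 1) * a * r"
    using a0 r by (cases "?N = 0") auto
  then have "(sqrt r * ?N)\<^sup>2 \<le> (sqrt (r - 1) * a * r)\<^sup>2"
    using r by (intro power_mono) auto
  then have "r * ?N\<^sup>2 \<le> r * ((r - 1) * a\<^sup>2 * r)"
    using r by (simp add: power_mult_distrib power2_eq_square[of r] algebra_simps)
  then have "?N\<^sup>2 \<le> (r - 1) * a\<^sup>2 * r"
    using r by (simp only: mult_le_cancel_left_pos)
  then have "(norm q)\<^sup>2 \<le> (a * r)\<^sup>2"
    unfolding qq by (simp add: power2_eq_square algebra_simps)
  moreover have "0 \<le> a * r"
    using a0 r by simp
  ultimately show ?thesis
    unfolding ar by (rule power2_le_imp_le)
qed

text \<open>Duality reverses the inclusion SSC1: a vector nonnegative on all rows of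
  \<open>H\<close> is nonnegative on the second-order cone.\<close>

lemma SSC1_dual_cone:
  fixes H :: "real^'r^'n"
  assumes H: "SSC1 H" and q: "0 \<le> H *v q"
  shows "norm q \<le> 1 \<bullet> q"
proof (rule mem_soc_dual_of_dual_cone)
  fix x :: "real^'r"
  assume x: "sqrt (real CARD('r) - 1) * norm x \<le> 1 \<bullet> x"
  then have "x \<in> mat_cone (transpose H)"
    using H nonneg_of_second_order_cone[OF x] unfolding SSC1_def by blast
  then obtain y where y: "0 \<le> y" and x_eq: "x = y v* H"
    by (auto simp: mat_cone_def)
  have "x \<bullet> q = y \<bullet> (H *v q)"
    unfolding x_eq by (rule dot_lmul_matrix)
  also have "\<dots> \<ge> 0"
    using y q by (auto simp: inner_vec_def less_eq_vec_def intro!: sum_nonneg)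
  finally show "0 \<le> x \<bullet> q" .
qed

text \<open>If \<open>q\<close> is in the kernel, the cone bound applies to both \<open>q\<close>
  and \<open>- q\<close>, which forces \<open>q = 0\<close>.\<close>

lemma SSC1_left_inverse:
  fixes H :: "real^'r^'n"
  assumes "SSC1 H"
  shows "\<exists>L. L ** H = mat 1"
proof -
  have "q = 0" if "H *v q = 0" for q
    using SSC1_dual_cone[OF assms, of q] SSC1_dual_cone[OF assms, of "- q"] that
    by (simp add: linear_neg[OF matrix_vector_mul_linear] norm_le_zero_iff[symmetric] del: norm_le_zero_iff)
  then show ?thesis
    by (metis matrix_left_invertible_ker)
qed

text \<open>Moving from \<open>q\<close> by \<open>- s\<close> times the all-ones vector lowers the
  entry sum by \<open>s * n\<^sup>2\<close> but the norm by at most \<open>s * n\<close>. Dimension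
  at least 2 gives \<open>n > 1\<close>, so the move leaves the cone.\<close>

lemma frontier_soc_dual:
  fixes q :: "real^'r"
  assumes r: "2 \<le> CARD('r)" and q: "norm q = 1 \<bullet> q"
  shows "q \<in> frontier soc_dual"
proof -
  have "q \<in> closure soc_dual"
    using q by (intro subsetD[OF closure_subset]) (simp add: soc_dual_def)
  moreover have "q \<notin> interior soc_dual"
  proof
    assume "q \<in> interior soc_dual"
    then obtain d where d: "d > 0" "ball q d \<subseteq> soc_dual"
      by (auto simp: mem_interior)
    define n where "n = norm (1::real^'r)"
    have n2: "n\<^sup>2 = real CARD('r)"
      unfolding n_def by (simp add: inner_1_1 flip: dot_square_norm)
    have n: "n > 1"
    proof (rule power2_less_imp_less)
      show "1\<^sup>2 < n\<^sup>2" unfolding n2 using r by simp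
    qed (simp add: n_def)
    \<comment> \<open>The displacement has norm \<open>s * n\<close>, half the radius of the
      ball.\<close>
    define s where "s = d / (2 * n)"
    have s: "s > 0" "s * n < d"
      using d n by (auto simp: s_def)
    have "q - s *\<^sub>R 1 \<in> ball q d"
      using s by (simp add: dist_norm n_def)
    then have "norm (q - s *\<^sub>R 1) \<le> 1 \<bullet> (q - s *\<^sub>R 1)"
      using d(2) unfolding soc_dual_def by blast
    also have "\<dots> = norm q - s * n\<^sup>2"
      by (simp add: inner_diff_right q inner_1_1 n2)
    finally have "s * n\<^sup>2 \<le> norm q - norm (q - s *\<^sub>R 1)"
      by simp
    also have "\<dots> \<le> s * n"
      using norm_triangle_ineq2[of q "q - s *\<^sub>R 1"] s by (simp add: n_def)
    finally show False
      using s n by (simp add: power2_eq_square)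
  qed
  ultimately show ?thesis
    by (simp add: frontier_def)
qed

text \<open>Transposing gives Q^T e = Q^T H^T e = (H Q)^T e = e. Moreover \<open>H\<close> maps
  column \<open>k\<close> of \<open>Q\<close> to the nonnegative column \<open>k\<close> of
  \<open>H ** Q\<close>, so the dual cone bound applies.\<close>

lemma stochastic_change_of_basis:
  fixes H :: "real^'r^'n" and Q :: "real^'r^'r"
  assumes H: "sufficiently_scattered H" and He: "transpose H *v 1 = 1"
    and U: "0 \<le> H ** Q" and Ue: "transpose (H ** Q) *v 1 = 1"
  shows "1 \<bullet> column k Q = 1" and "norm (column k Q) \<le> 1"
proof -
  have "transpose Q *v 1 = 1"
    using Ue He by (simp only: matrix_transpose_mul flip: matrix_vector_mul_assoc)
  then have "(transpose Q *v 1) $ k = 1"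
    by simp
  then show sum1: "1 \<bullet> column k Q = 1"
    by (simp add: inner_vec_def column_def vector_matrix_mult_def)
  have "0 \<le> H *v column k Q"
    using U by (simp add: less_eq_vec_def matrix_matrix_mult_def matrix_vector_mult_def column_def)
  then show "norm (column k Q) \<le> 1"
    using SSC1_dual_cone[of H "column k Q"] H sum1 by (simp add: sufficiently_scattered_def)
qed

lemma det_change_of_basis:
  fixes H :: "real^'r^'n" and Q :: "real^'r^'r"
  assumes H: "sufficiently_scattered H" "transpose H *v 1 = 1"
    and U: "0 \<le> H ** Q" "transpose (H ** Q) *v 1 = 1"
  shows "\<bar>det Q\<bar> \<le> 1"
proof -
  have "transpose Q $ i = column i Q" for i
    by (simp add: transpose_def column_def)
  then show ?thesis
    using det_le_1_of_norm_rows_le_1[of "transpose Q"] stochastic_change_of_basis(2)[OF H U] by simp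
qed

text \<open>The equality case of Hadamard puts each column on the boundary of the cone; SSC2 makes
  it a multiple of a standard basis vector, and entry sum 1 fixes the factor.\<close>

lemma permutation_change_of_basis:
  fixes H :: "real^'r^'n" and Q :: "real^'r^'r"
  assumes H: "sufficiently_scattered H" "transpose H *v 1 = 1"
    and U: "0 \<le> H ** Q" "transpose (H ** Q) *v 1 = 1"
    and det: "1 \<le> \<bar>det Q\<bar>"
  shows "permutation_matrix Q"
proof -
  have col: "transpose Q $ i = column i Q" for i
    by (simp add: transpose_def column_def)
  have "\<exists>j. column k Q = axis j 1" for k
  proof -
    let ?q = "column k Q"
    have "norm ?q = 1"
      using norm_row_eq_1_of_det_ge_1[of "transpose Q" k] stochastic_change_of_basis(2)[OF H U] det
      by (simp add: col)
    then have "?q \<in> frontier soc_dual"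
      using H stochastic_change_of_basis(1)[OF H U]
      by (intro frontier_soc_dual) (auto simp: sufficiently_scattered_def)
    moreover have "?q \<in> mat_dual_cone (transpose H)"
      using U unfolding mat_dual_cone_def
      by (simp add: less_eq_vec_def matrix_matrix_mult_def matrix_vector_mult_def column_def)
    ultimately have "?q \<in> {c *\<^sub>R axis k 1 | c k. 0 \<le> c}"
      using H unfolding sufficiently_scattered_def SSC2_def by blast
    then obtain c j where "?q = c *\<^sub>R axis j 1"
      by blast
    then show ?thesis
      using stochastic_change_of_basis(1)[OF H U, of k] by (auto simp: inner_1_axis)
  qed
  then obtain \<sigma> where \<sigma>: "\<And>k. column k Q = axis (\<sigma> k) 1"
    by metis
  \<comment> \<open>Two equal columns would make the determinant vanish.\<close>
  have "inj \<sigma>"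
    using \<sigma> det det_identical_columns[of _ _ Q] by (metis abs_zero injI not_one_le_zero)
  then have "bij \<sigma>"
    by (simp add: bij_def finite_UNIV_inj_surj)
  then have "\<sigma> permutes UNIV"
    by (simp add: permutes_def bij_iff)
  moreover have "Q = (\<chi> i j. if i = \<sigma> j then 1 else 0)"
    using \<sigma> by (simp add: vec_eq_iff column_def axis_def)
  ultimately show ?thesis
    unfolding permutation_matrix_def by blast
qed

lemma orthogonal_permutation_matrix:
  assumes "permutation_matrix P"
  shows "orthogonal_matrix P"
proof -
  from assms obtain \<sigma> where \<sigma>: "\<sigma> permutes UNIV" and P: "P = (\<chi> i j. if i = \<sigma> j then 1 else 0)"
    unfolding permutation_matrix_def by blast
  have "\<sigma> i = \<sigma> j \<longleftrightarrow> i = j" for i j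
    using permutes_inj[OF \<sigma>] by (auto dest: injD)
  then show ?thesis
    unfolding orthogonal_matrix P
    by (simp add: matrix_matrix_mult_def transpose_def mat_def vec_eq_iff if_distrib[of "\<lambda>x. x * _"]
        sum.delta cong: if_cong)
qed

section \<open>Moore-Penrose inverses, ranks and Gram determinants\<close>

text \<open>Both products are symmetric projections onto the range of \<open>A\<close>, so each
  absorbs the other; transposing swaps the order.\<close>

lemma moore_penrose_range_projection_unique:
  assumes X: "is_moore_penrose A X" and Y: "is_moore_penrose A Y"
  shows "A ** X = A ** Y"
proof -
  have "A ** X = (A ** Y) ** (A ** X)"
    using Y by (simp add: is_moore_penrose_def matrix_mul_assoc)
  also have "\<dots> = transpose ((A ** X) ** (A ** Y))"
    using X Y unfolding matrix_transpose_mul[of "A ** X"] by (simp add: is_moore_penrose_def)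
  also have "\<dots> = transpose (A ** Y)"
    using X by (simp add: is_moore_penrose_def matrix_mul_assoc)
  also have "\<dots> = A ** Y"
    using Y by (simp add: is_moore_penrose_def)
  finally show ?thesis .
qed

text \<open>Exchanges the roles of \<open>A ** X\<close> and \<open>X ** A\<close>, so uniqueness of
  the range projection covers both products.\<close>

lemma is_moore_penrose_transpose:
  assumes "is_moore_penrose A X"
  shows "is_moore_penrose (transpose A) (transpose X)"
proof -
  have "transpose (A ** X ** A) = transpose A" "transpose (X ** A ** X) = transpose X"
    "A ** X = transpose (A ** X)" "X ** A = transpose (X ** A)"
    using assms by (simp_all add: is_moore_penrose_def)
  then show ?thesis
    by (simp only: is_moore_penrose_def matrix_transpose_mul transpose_transpose matrix_mul_assoc simp_thms)
qed

lemma moore_penrose_unique: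
  assumes X: "is_moore_penrose A X" and Y: "is_moore_penrose A Y"
  shows "X = Y"
proof -
  have AX: "A ** X = A ** Y"
    by (rule moore_penrose_range_projection_unique[OF X Y])
  have "transpose (X ** A) = transpose (Y ** A)"
    using moore_penrose_range_projection_unique[OF is_moore_penrose_transpose[OF X]
        is_moore_penrose_transpose[OF Y]] by (simp only: matrix_transpose_mul)
  then have XA: "X ** A = Y ** A"
    by simp
  have "X = X ** A ** X"
    using X by (simp add: is_moore_penrose_def)
  also have "\<dots> = Y ** (A ** X)"
    by (simp add: XA matrix_mul_assoc)
  also have "\<dots> = Y"
    using Y by (simp add: AX is_moore_penrose_def matrix_mul_assoc)
  finally show ?thesis .
qed

lemma pinv_eqI: "is_moore_penrose A X \<Longrightarrow> pinv A = X"
  unfolding pinv_def by (blast intro: moore_penrose_unique)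

lemma inner_gram: "x \<bullet> (transpose A ** A *v x) = (norm (A *v x))\<^sup>2" for A :: "real^'n^'m"
proof -
  have "x \<bullet> (transpose A ** A *v x) = (x v* transpose A) \<bullet> (A *v x)"
    by (simp only: dot_lmul_matrix matrix_vector_mul_assoc)
  then show ?thesis
    by (simp add: dot_square_norm)
qed

lemma moore_penrose_full_column_rank:
  fixes A :: "real^'n^'m"
  assumes L: "L ** A = mat 1"
  shows "\<exists>X. is_moore_penrose A X \<and> X ** A = mat 1"
proof -
  let ?G = "transpose A ** A"
  have "x = 0" if "?G *v x = 0" for x
  proof -
    have "A *v x = 0"
      using inner_gram[of x A] that by simp
    then have "(L ** A) *v x = 0"
      by (simp flip: matrix_vector_mul_assoc)
    then show ?thesis
      by (simp add: L)
  qed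
  then obtain B where B: "B ** ?G = mat 1"
    by (metis matrix_left_invertible_ker)
  \<comment> \<open>\<open>B\<close> is the inverse of the symmetric Gram matrix, hence symmetric;
    this makes \<open>A ** ?X\<close> symmetric.\<close>
  have "transpose (B ** ?G) = ?G ** transpose B"
    by (simp add: matrix_transpose_mul)
  then have BT: "transpose B = B"
    using B by (metis matrix_mul_assoc matrix_mul_lid matrix_mul_rid transpose_mat)
  let ?X = "B ** transpose A"
  have XA: "?X ** A = mat 1"
    using B by (simp add: matrix_mul_assoc)
  moreover have "transpose (A ** ?X) = A ** ?X"
    by (simp add: matrix_transpose_mul BT matrix_mul_assoc)
  moreover have "A ** ?X ** A = A"
    using XA by (metis matrix_mul_assoc matrix_mul_rid)
  ultimately show ?thesis
    by (intro exI[of _ ?X]) (simp add: is_moore_penrose_def)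
qed

lemma pinv_full_column_rank:
  fixes A :: "real^'n^'m"
  assumes "L ** A = mat 1"
  shows "pinv A ** A = mat 1" and "transpose A ** pinv (transpose A) = mat 1"
proof -
  obtain X where X: "is_moore_penrose A X" "X ** A = mat 1"
    using moore_penrose_full_column_rank[OF assms] by blast
  then show "pinv A ** A = mat 1"
    by (simp add: pinv_eqI)
  show "transpose A ** pinv (transpose A) = mat 1"
    using X by (simp add: pinv_eqI[OF is_moore_penrose_transpose[OF X(1)]] flip: matrix_transpose_mul)
qed

text \<open>The inner dimension caps the rank of each factor, and the rank of the product bounds it
  below.\<close>

lemma full_rank_factors:
  fixes A :: "real^'r^'m" and B :: "real^'n^'r"
  assumes "rank (A ** B) = CARD('r)"
  shows "\<exists>L. L ** A = mat 1" and "\<exists>R. B ** R = mat 1"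
proof -
  have "rank A = CARD('r)"
    using assms rank_mul_le_left[of A B] rank_bound[of A] by simp
  then show "\<exists>L. L ** A = mat 1"
    by (simp add: full_rank_injective matrix_left_invertible_injective)
  have "rank B = CARD('r)"
    using assms rank_mul_le_right[of A B] rank_bound[of B] by simp
  then show "\<exists>R. B ** R = mat 1"
    by (simp add: full_rank_surjective matrix_right_invertible_surjective)
qed

lemma det_pos_of_pos_def:
  fixes M :: "real^'n^'n"
  assumes M: "\<And>x. x \<noteq> 0 \<Longrightarrow> 0 < x \<bullet> (M *v x)"
  shows "0 < det M"
proof (rule ccontr)
  \<comment> \<open>the determinant has no zero on the segment from \<open>M\<close> to the identity\<close>
  let ?M = "\<lambda>t. t *\<^sub>R mat 1 + (1 - t) *\<^sub>R M"
  assume "\<not> 0 < det M"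
  moreover have "continuous_on {0..1} (\<lambda>t. det (?M t))"
    by (intro continuous_on_compose2[OF continuous_on_det[of UNIV]] continuous_intros) auto
  ultimately obtain t where t: "0 \<le> t" "t \<le> 1" "det (?M t) = 0"
    using IVT'[of "\<lambda>t. det (?M t)" 0 0 1] by auto
  then obtain x where x: "x \<noteq> 0" "?M t *v x = 0"
    using invertible_det_nz[of "?M t"] by (metis invertible_left_inverse matrix_left_invertible_ker)
  \<comment> \<open>The quadratic form vanishes at the kernel vector \<open>x\<close>, yet it is a
    convex combination of two positive numbers.\<close>
  have "x \<bullet> (?M t *v x) = t * (x \<bullet> x) + (1 - t) * (x \<bullet> (M *v x))"
    by (simp add: matrix_vector_mult_add_rdistrib inner_add_right scaleR_matrix_vector_assoc[symmetric])
  moreover have "0 < t * (x \<bullet> x) + (1 - t) * (x \<bullet> (M *v x))"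
  proof (cases "t = 0")
    case False
    then show ?thesis
      using t x M[OF x(1)] by (intro add_pos_nonneg) auto
  qed (use M[OF x(1)] in simp)
  ultimately show False
    using x by simp
qed

text \<open>Positivity allows this determinant to be cancelled when objective values are
  compared.\<close>

lemma det_gram_pos:
  fixes A :: "real^'n^'m"
  assumes L: "L ** A = mat 1"
  shows "0 < det (transpose A ** A)"
proof (rule det_pos_of_pos_def)
  fix x :: "real^'n" assume "x \<noteq> 0"
  then have "A *v x \<noteq> 0"
    using L by (metis matrix_vector_mul_assoc matrix_vector_mul_lid matrix_vector_mult_0_right)
  then show "0 < x \<bullet> (transpose A ** A *v x)"
    by (simp add: inner_gram)
qed

section \<open>Identifiability of the two steps\<close>

text \<open>The cores are related by K = Q1 S Q2^T. Optimality and \<open>det S \<noteq> 0\<close>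
  give |det Q1| |det Q2| \<ge> 1, while each factor is at most 1.\<close>

lemma step1_identifiable:
  fixes H1 :: "real^'r^'n1" and H2 :: "real^'r^'n2" and K :: "real^'r^'r"
  assumes M: "M = H1 ** K ** transpose H2" and rank: "rank M = CARD('r)"
    and H1: "sufficiently_scattered H1" "transpose H1 *v 1 = 1"
    and H2: "sufficiently_scattered H2" "transpose H2 *v 1 = 1"
    and opt: "step1_optimal M (U1, U2, S)"
  shows "\<exists>P1 P2. permutation_matrix P1 \<and> permutation_matrix P2 \<and> U1 = H1 ** P1 \<and> U2 = H2 ** P2"
proof -
  have feas: "M = U1 ** S ** transpose U2" "transpose U1 *v 1 = 1" "transpose U2 *v 1 = 1"
      "0 \<le> U1" "0 \<le> U2"
    using opt by (auto simp: step1_optimal_def is_arg_min_def step1_feasible_def)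
  have min: "\<And>V1 V2 (W :: real^'r^'r). step1_feasible M (V1, V2, W) \<Longrightarrow> \<bar>det S\<bar> \<le> \<bar>det W\<bar>"
    using opt by (force simp: step1_optimal_def is_arg_min_linorder)
  have "step1_feasible M (H1, H2, K)"
    using H1 H2 by (simp add: step1_feasible_def M sufficiently_scattered_def)
  then have le: "\<bar>det S\<bar> \<le> \<bar>det K\<bar>"
    by (rule min)
  obtain R where R: "(S ** transpose U2) ** R = mat 1"
    using full_rank_factors(2)[of U1 "S ** transpose U2"] rank feas(1) by (auto simp: matrix_mul_assoc)
  obtain L where L: "L ** (U1 ** S) = mat 1"
    using full_rank_factors(1)[of "U1 ** S" "transpose U2"] rank feas(1) by auto
  \<comment> \<open>\<open>H1 ** Q1\<close> is \<open>M ** R\<close>, and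
    \<open>transpose Q2 ** transpose H2\<close> is \<open>L ** M\<close>: the inverses
    \<open>R\<close> and \<open>L\<close> isolate \<open>U1\<close> and \<open>transpose U2\<close>
    in \<open>M\<close>.\<close>
  define Q1 where "Q1 = K ** transpose H2 ** R"
  define Q2 where "Q2 = transpose (L ** H1 ** K)"
  have "U1 = (U1 ** S ** transpose U2) ** R"
    using R by (metis matrix_mul_assoc matrix_mul_rid)
  then have Q1: "U1 = H1 ** Q1"
    unfolding feas(1)[symmetric] M Q1_def by (simp add: matrix_mul_assoc)
  have "transpose U2 = L ** (U1 ** S ** transpose U2)"
    using L by (metis matrix_mul_assoc matrix_mul_lid)
  then have "transpose U2 = transpose Q2 ** transpose H2"
    unfolding feas(1)[symmetric] M Q2_def by (simp add: matrix_mul_assoc)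
  then have Q2: "U2 = H2 ** Q2"
    by (metis matrix_transpose_mul transpose_transpose)
  \<comment> \<open>Left inverses of the true factors make the core of a factorization
    unique.\<close>
  obtain L1 L2 where L1: "L1 ** H1 = mat 1" and L2: "L2 ** H2 = mat 1"
    using SSC1_left_inverse H1(1) H2(1) by (metis sufficiently_scattered_def)
  have R2: "transpose H2 ** transpose L2 = mat 1"
    using L2 by (metis matrix_transpose_mul transpose_mat)
  have core: "L1 ** (H1 ** X ** transpose H2) ** transpose L2 = X" for X
    using L1 R2 by (metis matrix_mul_assoc matrix_mul_lid matrix_mul_rid)
  have "H1 ** K ** transpose H2 = H1 ** (Q1 ** S ** transpose Q2) ** transpose H2"
    using feas(1) unfolding M Q1 Q2 by (simp add: matrix_transpose_mul matrix_mul_assoc)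
  then have "K = Q1 ** S ** transpose Q2"
    using core by metis
  then have det_K: "\<bar>det K\<bar> = \<bar>det Q1\<bar> * \<bar>det Q2\<bar> * \<bar>det S\<bar>"
    by (simp add: det_mul abs_mult)
  have "rank S = CARD('r)"
  proof -
    have "rank M \<le> rank S"
      unfolding feas(1) using rank_mul_le_left rank_mul_le_right order_trans by blast
    then show ?thesis
      using rank rank_bound[of S] by simp
  qed
  then have "0 < \<bar>det S\<bar>"
    using det_eq_0_rank[of S] by simp
  then have ge: "1 \<le> \<bar>det Q1\<bar> * \<bar>det Q2\<bar>"
    using le unfolding det_K by simp
  have det1: "\<bar>det Q1\<bar> \<le> 1" and det2: "\<bar>det Q2\<bar> \<le> 1"
    using det_change_of_basis[OF H1] det_change_of_basis[OF H2] feas Q1 Q2 by auto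
  have "1 \<le> \<bar>det Q1\<bar>"
    using ge mult_left_mono[OF det2, of "\<bar>det Q1\<bar>"] by simp
  moreover have "1 \<le> \<bar>det Q2\<bar>"
    using ge mult_right_mono[OF det1, of "\<bar>det Q2\<bar>"] by simp
  ultimately have "permutation_matrix Q1" "permutation_matrix Q2"
    using permutation_change_of_basis[OF H1] permutation_change_of_basis[OF H2] feas Q1 Q2 by auto
  then show ?thesis
    using Q1 Q2 by blast
qed

text \<open>K = G Q^T multiplies the Gram determinant of \<open>G\<close> by
  \<open>(det Q)\<^sup>2\<close>, so optimality yields |det Q| \<ge> 1.\<close>

lemma step2_identifiable:
  fixes H :: "real^'r^'n" and K :: "real^'r^'p"
  assumes S: "S = K ** transpose H" and K: "inj ((*v) K)"
    and H: "sufficiently_scattered H" "transpose H *v 1 = 1"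
    and opt: "step2_optimal S (G, U)"
  shows "\<exists>P. permutation_matrix P \<and> U = H ** P \<and> G = K ** P"
proof -
  have feas: "S = G ** transpose U" "transpose U *v 1 = 1" "0 \<le> U"
    using opt by (auto simp: step2_optimal_def is_arg_min_def step2_feasible_def)
  have min: "\<And>V (W :: real^'r^'n). step2_feasible S (V, W) \<Longrightarrow> det (transpose G ** G) \<le> det (transpose V ** V)"
    using opt by (force simp: step2_optimal_def is_arg_min_linorder)
  have "step2_feasible S (K, H)"
    using H by (simp add: step2_feasible_def S sufficiently_scattered_def)
  then have le: "det (transpose G ** G) \<le> det (transpose K ** K)"
    by (rule min)
  obtain LH where "LH ** H = mat 1"
    using SSC1_left_inverse H(1) by (metis sufficiently_scattered_def)
  then have RH: "transpose H ** transpose LH = mat 1"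
    by (metis matrix_transpose_mul transpose_mat)
  have K_eq: "K = G ** (transpose U ** transpose LH)"
    using S feas(1) RH by (metis matrix_mul_assoc matrix_mul_rid)
  have "rank (G ** (transpose U ** transpose LH)) = CARD('r)"
    using K by (simp add: full_rank_injective flip: K_eq)
  then obtain L where L: "L ** G = mat 1"
    using full_rank_factors(1) by blast
  define Q where "Q = transpose (L ** K)"
  have "transpose U = L ** S"
    unfolding feas(1) using L by (simp add: matrix_mul_assoc)
  then have "transpose U = transpose Q ** transpose H"
    unfolding S Q_def by (simp add: matrix_mul_assoc)
  then have U: "U = H ** Q"
    by (metis matrix_transpose_mul transpose_transpose)
  have KQ: "K = G ** transpose Q"
    unfolding K_eq U using RH by (metis matrix_mul_assoc matrix_mul_rid matrix_transpose_mul)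
  have "transpose K ** K = Q ** (transpose G ** G) ** transpose Q"
    unfolding KQ by (simp add: matrix_transpose_mul matrix_mul_assoc)
  then have "det (transpose K ** K) = (det Q)\<^sup>2 * det (transpose G ** G)"
    by (simp only: det_mul det_transpose power2_eq_square mult_ac)
  then have "1 \<le> (det Q)\<^sup>2"
    using le det_gram_pos[OF L] by simp
  then have "1 \<le> \<bar>det Q\<bar>"
    by (simp add: abs_le_square_iff[of 1, simplified])
  then have Q: "permutation_matrix Q"
    using permutation_change_of_basis[OF H] feas U by simp
  then have "transpose Q ** Q = mat 1"
    using orthogonal_permutation_matrix orthogonal_matrix by blast
  then have "G = K ** Q"
    unfolding KQ by (metis matrix_mul_assoc matrix_mul_rid)
  then show ?thesis
    using Q U by blast
qed

section \<open>Slices and unfoldings of tensors\<close>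

text \<open>All slices share the outer factors \<open>A\<close> and \<open>B\<close>; the third
  factor enters only through the core matrix, a combination of the slices of \<open>G\<close>
  weighted by row \<open>k\<close> of \<open>C\<close>.\<close>

lemma slice3_tensor_apply:
  "slice3 (tensor_apply A B C G) k =
    A ** (\<chi> i j. (unfold3 G *v C $ k) $ (i, j)) ** transpose B"
proof -
  have "(\<Sum>i\<in>UNIV. \<Sum>j\<in>UNIV. \<Sum>l\<in>UNIV. A $ a $ i * B $ b $ j * C $ k $ l * G $ i $ j $ l) =
      (\<Sum>j\<in>UNIV. (\<Sum>i\<in>UNIV. A $ a $ i * (\<Sum>l\<in>UNIV. G $ i $ j $ l * C $ k $ l)) * B $ b $ j)" for a b
    by (subst sum.swap) (simp add: sum_distrib_left sum_distrib_right mult_ac)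
  then show ?thesis
    by (simp add: slice3_def tensor_apply_def unfold3_def matrix_matrix_mult_def matrix_vector_mult_def
        transpose_def vec_eq_iff)
qed

text \<open>Splits off the third mode as a right factor, the shape of the constraint in the second
  step.\<close>

lemma unfold3_tensor_apply:
  "unfold3 (tensor_apply A B C G) = unfold3 (tensor_apply A B (mat 1) G) ** transpose C"
proof -
  have "(\<Sum>i\<in>UNIV. \<Sum>j\<in>UNIV. \<Sum>l\<in>UNIV. A $ a $ i * B $ b $ j * C $ k $ l * G $ i $ j $ l) =
      (\<Sum>m\<in>UNIV. (\<Sum>i\<in>UNIV. \<Sum>j\<in>UNIV. \<Sum>l\<in>UNIV.
        A $ a $ i * B $ b $ j * mat 1 $ m $ l * G $ i $ j $ l) * C $ k $ m)"
    (is "_ = ?rhs") for a b k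
  proof -
    let ?g = "\<lambda>i j m. A $ a $ i * B $ b $ j * C $ k $ m * G $ i $ j $ m"
    have "(\<Sum>l\<in>UNIV. A $ a $ i * B $ b $ j * mat 1 $ m $ l * G $ i $ j $ l) =
        A $ a $ i * B $ b $ j * G $ i $ j $ m" for i j m
      by (simp add: mat_def if_distrib[of "\<lambda>x. _ * x"] if_distrib[of "\<lambda>x. x * _"] cong: if_cong)
    then have "?rhs = (\<Sum>m\<in>UNIV. \<Sum>i\<in>UNIV. \<Sum>j\<in>UNIV. ?g i j m)"
      by (simp add: sum_distrib_left sum_distrib_right mult_ac)
    also have "\<dots> = (\<Sum>i\<in>UNIV. \<Sum>m\<in>UNIV. \<Sum>j\<in>UNIV. ?g i j m)"
      by (rule sum.swap)
    also have "\<dots> = (\<Sum>i\<in>UNIV. \<Sum>j\<in>UNIV. \<Sum>m\<in>UNIV. ?g i j m)"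
      by (intro sum.cong sum.swap) auto
    finally show ?thesis ..
  qed
  then show ?thesis
    by (simp add: tensor_apply_def unfold3_def matrix_matrix_mult_def transpose_def vec_eq_iff)
qed

lemma unfold3_inject: "unfold3 G = unfold3 G' \<Longrightarrow> G = G'"
  by (simp add: unfold3_def vec_eq_iff split_paired_all)

lemma slice3_eq_unfold3: "slice3 G k $ i $ j = unfold3 G $ (i, j) $ k"
  by (simp add: slice3_def unfold3_def)

text \<open>On unfoldings the first two modes act as an invertible Kronecker product; the slice
  formula replaces that product.\<close>

lemma inj_unfold3_tensor_apply:
  fixes A :: "real^'a^'a" and B :: "real^'b^'b"
  assumes G: "inj ((*v) (unfold3 G))" and A: "orthogonal_matrix A" and B: "orthogonal_matrix B"
  shows "inj ((*v) (unfold3 (tensor_apply A B (mat 1) G)))"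
proof -
  have "y = 0" if y: "unfold3 (tensor_apply A B (mat 1) G) *v y = 0" for y
  proof -
    \<comment> \<open>Using \<open>y\<close> as the only row of a third factor turns the product
      with \<open>y\<close> into a single slice.\<close>
    let ?C = "(\<chi> k. y) :: real^_^1"
    let ?N = "\<chi> i j. (unfold3 G *v y) $ (i, j)"
    have "unfold3 (tensor_apply A B ?C G) = 0"
      using y unfolding unfold3_tensor_apply[of A B ?C]
      by (simp add: vec_eq_iff matrix_matrix_mult_def matrix_vector_mult_def transpose_def)
    then have "slice3 (tensor_apply A B ?C G) 1 = 0"
      by (simp add: vec_eq_iff slice3_eq_unfold3)
    then have "A ** ?N ** transpose B = 0"
      by (simp add: slice3_tensor_apply)
    then have "transpose A ** (A ** ?N ** transpose B) ** B = 0"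
      by (simp add: matrix_matrix_mult_def vec_eq_iff)
    moreover have "transpose A ** (A ** ?N ** transpose B) ** B = ?N"
      using A B unfolding orthogonal_matrix by (metis matrix_mul_assoc matrix_mul_lid matrix_mul_rid)
    ultimately have "unfold3 G *v y = 0"
      by (simp add: vec_eq_iff)
    then show ?thesis
      using G by (metis injD matrix_vector_mult_0_right)
  qed
  then show ?thesis
    by (metis matrix_left_invertible_injective matrix_left_invertible_ker)
qed

text \<open>The pseudoinverses cancel \<open>U1\<close> and \<open>transpose U2\<close> in every
  slice.\<close>

lemma step2_matrix_eq_unfold3:
  assumes L1: "L1 ** U1 = mat 1" and L2: "L2 ** U2 = mat 1"
  shows "step2_matrix (tensor_apply (U1 ** A) (U2 ** B) C G) U1 U2 = unfold3 (tensor_apply A B C G)"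
proof -
  have "pinv U1 ** slice3 (tensor_apply (U1 ** A) (U2 ** B) C G) k ** pinv (transpose U2) =
      slice3 (tensor_apply A B C G) k" for k
  proof -
    let ?N = "\<chi> i j. (unfold3 G *v C $ k) $ (i, j)"
    have "pinv U1 ** slice3 (tensor_apply (U1 ** A) (U2 ** B) C G) k ** pinv (transpose U2) =
        (pinv U1 ** U1) ** (A ** ?N ** transpose B) ** (transpose U2 ** pinv (transpose U2))"
      by (simp add: slice3_tensor_apply matrix_transpose_mul matrix_mul_assoc)
    then show ?thesis
      by (simp add: pinv_full_column_rank(1)[OF L1] pinv_full_column_rank(2)[OF L2] slice3_tensor_apply)
  qed
  then show ?thesis
    by (simp add: step2_matrix_def vectorize_def vec_eq_iff slice3_eq_unfold3)
qed

section \<open>Recovery of the three factors and the core tensor\<close>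

theorem theorem5p16:
  fixes T :: "('n1::finite, 'n2::finite, 'n3::finite) tensor3"
    and U1h U1s :: "real^'r::finite^'n1"
    and U2h U2s :: "real^'r^'n2"
    and U3h U3s :: "real^'r3::finite^'n3"
    and Gh Gs :: "('r, 'r, 'r3) tensor3"
    and istar :: 'n3
  assumes T: "T = tensor_apply U1h U2h U3h Gh"
    and nonneg: "0 \<le> U1h" "0 \<le> U2h" "0 \<le> U3h"
    and stochastic: "transpose U1h *v all_ones = all_ones"
      "transpose U2h *v all_ones = all_ones"
      "transpose U3h *v all_ones = all_ones"
    and r3: "sqrt (real CARD('r3)) \<le> real CARD('r)"
    and SSC: "sufficiently_scattered U1h" "sufficiently_scattered U2h" "sufficiently_scattered U3h"
    and rank_slice: "rank (slice3 T istar) = CARD('r)"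
    and rank_core: "rank (unfold3 Gh) = CARD('r3)"
    and proc: "procedure_output T istar U1s U2s U3s Gs"
  shows "\<exists>(P1 :: real^'r^'r) (P2 :: real^'r^'r) (P3 :: real^'r3^'r3).
    permutation_matrix P1 \<and> permutation_matrix P2 \<and> permutation_matrix P3 \<and>
    U1s = U1h ** P1 \<and> U2s = U2h ** P2 \<and> U3s = U3h ** P3 \<and>
    Gs = tensor_apply (transpose P1) (transpose P2) (transpose P3) Gh"
proof -
  let ?M = "slice3 T istar"
  have e: "transpose U1h *v 1 = 1" "transpose U2h *v 1 = 1" "transpose U3h *v 1 = 1"
    using stochastic by auto
  from proc obtain S where step1: "step1_optimal ?M (U1s, U2s, S)"
    and step2: "step2_optimal (step2_matrix T U1s U2s) (unfold3 Gs, U3s)"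
    unfolding procedure_output_def by blast
  obtain P1 P2 where P1: "permutation_matrix P1" and P2: "permutation_matrix P2"
    and U1: "U1s = U1h ** P1" and U2: "U2s = U2h ** P2"
    using step1_identifiable[OF _ rank_slice SSC(1) e(1) SSC(2) e(2) step1]
    unfolding T slice3_tensor_apply by blast
  have O1: "orthogonal_matrix P1" and O2: "orthogonal_matrix P2"
    using P1 P2 by (simp_all add: orthogonal_permutation_matrix)
  \<comment> \<open>Writing the true factors through the computed ones moves the permutations into
    the core.\<close>
  have U1h: "U1h = U1s ** transpose P1" and U2h: "U2h = U2s ** transpose P2"
    using O1 O2 unfolding U1 U2 orthogonal_matrix_def by (metis matrix_mul_assoc matrix_mul_rid)+
  obtain L1 L2 where "L1 ** U1h = mat 1" "L2 ** U2h = mat 1"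
    using SSC SSC1_left_inverse by (metis sufficiently_scattered_def)
  then have L1: "(transpose P1 ** L1) ** U1s = mat 1" and L2: "(transpose P2 ** L2) ** U2s = mat 1"
    using O1 O2 unfolding U1 U2 orthogonal_matrix by (metis matrix_mul_assoc matrix_mul_rid)+
  let ?G = "tensor_apply (transpose P1) (transpose P2) (mat 1) Gh"
  have "step2_matrix T U1s U2s = unfold3 (tensor_apply (transpose P1) (transpose P2) U3h Gh)"
    unfolding T by (subst U1h, subst U2h) (rule step2_matrix_eq_unfold3[OF L1 L2])
  also have "\<dots> = unfold3 ?G ** transpose U3h"
    by (rule unfold3_tensor_apply)
  finally have "step2_matrix T U1s U2s = unfold3 ?G ** transpose U3h" .
  moreover have "inj ((*v) (unfold3 ?G))"
    using rank_core O1 O2 by (intro inj_unfold3_tensor_apply) (simp_all add: full_rank_injective)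
  ultimately obtain P3 where P3: "permutation_matrix P3" and U3: "U3s = U3h ** P3"
    and "unfold3 Gs = unfold3 ?G ** P3"
    using step2_identifiable[OF _ _ SSC(3) e(3) step2] by blast
  \<comment> \<open>The right factor \<open>P3\<close> is the transpose of
    \<open>transpose P3\<close>, so it is absorbed as the third mode.\<close>
  then have "unfold3 Gs = unfold3 (tensor_apply (transpose P1) (transpose P2) (transpose P3) Gh)"
    unfolding unfold3_tensor_apply[of _ _ "transpose P3"] by simp
  then have "Gs = tensor_apply (transpose P1) (transpose P2) (transpose P3) Gh"
    by (rule unfold3_inject)
  then show ?thesis
    using P1 P2 P3 U1 U2 U3 by blast
qed

end
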